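(* Identify $\mathbb{R}^4$, with coordinates $(q_1,q_2,q_3,q_4)$, with $\mathbb{C}^2$ via $z_1=q_1+iq_2$, $z_2=q_3-iq_4$. Let $\phi$ be a holomorphic function (on an open subset) of the form $$\phi(z_1,z_2)=a(z_2)+b(z_2)\,z_1,$$ where $a$ and $b$ are holomorphic functions of one variable. Then the real part $f=\operatorname{Re}\phi$, viewed as a function of $(q_1,q_2,q_3,q_4)$, is a regular solution of the Plebanski II equation.
   Context: The Plebanski II equation for a function $f$ of $(q_1,q_2,q_3,q_4)$ is $$\frac{\partial^2 f}{\partial q_1^2}\frac{\partial^2 f}{\partial q_2^2}-\Big(\frac{\partial^2 f}{\partial q_1\partial q_2}\Big)^2+\frac{\partial^2 f}{\partial q_2\partial q_4}-\frac{\partial^2 f}{\partial q_1\partial q_3}=0 .$$ A regular solution is a smooth function $f$ satisfying this equation on its domain. *)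

theory Defs
  imports "HOL-Complex_Analysis.Complex_Analysis"
begin

definition partial_deriv :: "'n::finite \<Rightarrow> (real ^ 'n \<Rightarrow> real) \<Rightarrow> real ^ 'n \<Rightarrow> real" where
  "partial_deriv i f q = deriv (\<lambda>t. f (q + t *\<^sub>R axis i 1)) 0"

(* Existence of the partial derivatives is demanded separately, because deriv is total. *)
primrec Ck_on :: "nat \<Rightarrow> (real ^ 'n::finite \<Rightarrow> real) \<Rightarrow> (real ^ 'n) set \<Rightarrow> bool" where
  "Ck_on 0 f U \<longleftrightarrow> continuous_on U f"
| "Ck_on (Suc k) f U \<longleftrightarrow>
     continuous_on U f \<and>
     (\<forall>i. (\<forall>q\<in>U. (\<lambda>t. f (q + t *\<^sub>R axis i 1)) differentiable (at 0)) \<and>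
          Ck_on k (partial_deriv i f) U)"

definition smooth_on :: "(real ^ 'n::finite \<Rightarrow> real) \<Rightarrow> (real ^ 'n) set \<Rightarrow> bool" where
  "smooth_on f U \<longleftrightarrow> (\<forall>k. Ck_on k f U)"

(* Only the values of f on the open set U matter: U is the domain of f. *)
definition regular_plebanski_II_solution :: "(real ^ 4 \<Rightarrow> real) \<Rightarrow> (real ^ 4) set \<Rightarrow> bool" where
  "regular_plebanski_II_solution f U \<longleftrightarrow>
     open U \<and> smooth_on f U \<and>
     (\<forall>q\<in>U.
        partial_deriv 1 (partial_deriv 1 f) q * partial_deriv 2 (partial_deriv 2 f) q
        - (partial_deriv 1 (partial_deriv 2 f) q)\<^sup>2
        + partial_deriv 2 (partial_deriv 4 f) q
        - partial_deriv 1 (partial_deriv 3 f) q = 0)"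

definition complex_coords :: "real ^ 4 \<Rightarrow> complex \<times> complex" where
  "complex_coords q =
     (of_real (q $ 1) + \<i> * of_real (q $ 2), of_real (q $ 3) - \<i> * of_real (q $ 4))"

(* The library's holomorphic_on is for one variable. In two variables: the (real) Frechet
   derivative exists and is complex linear. *)
definition holomorphic2_on :: "(complex \<times> complex \<Rightarrow> complex) \<Rightarrow> (complex \<times> complex) set \<Rightarrow> bool" where
  "holomorphic2_on \<phi> \<Omega> \<longleftrightarrow>
     open \<Omega> \<and>
     (\<forall>z\<in>\<Omega>. \<exists>A B. (\<phi> has_derivative (\<lambda>h. A * fst h + B * snd h)) (at z))"

end

theory Submission
  imports Defs
begin

text \<open>
  The functions \<open>Re (a(z\<^sub>2) + b(z\<^sub>2) z\<^sub>1)\<close> are closed under partial differentiation: the derivative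
  in a direction with complex coordinates \<open>(u, v)\<close> replaces \<open>(a, b)\<close> by \<open>(v a' + u b, v b')\<close>.
  Smoothness follows by induction. For the four coordinate directions \<open>(u, v)\<close> is \<open>(1, 0)\<close>,
  \<open>(\<i>, 0)\<close>, \<open>(0, 1)\<close>, \<open>(0, -\<i>)\<close>, so \<open>f\<^sub>1\<^sub>1 = f\<^sub>2\<^sub>2 = f\<^sub>1\<^sub>2 = 0\<close> and \<open>f\<^sub>2\<^sub>4 = Re b' = f\<^sub>1\<^sub>3\<close>.
\<close>

definition re_affine :: "(complex \<Rightarrow> complex) \<Rightarrow> (complex \<Rightarrow> complex) \<Rightarrow> real ^ 4 \<Rightarrow> real" where
  "re_affine a b q = Re (a (snd (complex_coords q)) + b (snd (complex_coords q)) * fst (complex_coords q))"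

lemma linear_complex_coords: "linear complex_coords"
  by (rule linearI) (auto simp: complex_coords_def complex_eq_iff)

lemma complex_coords_axis:
  "complex_coords (axis 1 1) = (1, 0)"
  "complex_coords (axis 2 1) = (\<i>, 0)"
  "complex_coords (axis 3 1) = (0, 1)"
  "complex_coords (axis 4 1) = (0, - \<i>)"
  by (simp_all add: complex_coords_def axis_def)

lemma continuous_on_complex_coords: "continuous_on S complex_coords"
  using linear_complex_coords linear_conv_bounded_linear linear_continuous_on by blast

text \<open>Along the complex line \<open>s \<mapsto> (z1 + s * u, z2 + s * v)\<close> the function
  inside \<open>Re\<close> is holomorphic in \<open>s\<close> near 0, so the product and chain rules
  apply; restricting \<open>s\<close> to real values and taking real parts gives the claim.\<close>

lemma has_real_derivative_re_affine:
  assumes "open V" "a holomorphic_on V" "b holomorphic_on V" "snd (complex_coords q) \<in> V"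
    and "complex_coords e = (u, v)"
  shows "((\<lambda>t. re_affine a b (q + t *\<^sub>R e)) has_real_derivative
           re_affine (\<lambda>z. v * deriv a z + u * b z) (\<lambda>z. v * deriv b z) q) (at 0)"
proof -
  obtain z1 z2 where z: "complex_coords q = (z1, z2)"
    by fastforce
  define A B where "A = deriv a z2" and "B = deriv b z2"
  have "z2 \<in> V"
    using assms z by simp
  have d: "(a has_field_derivative A) (at z2)" "(b has_field_derivative B) (at z2)"
    using assms \<open>z2 \<in> V\<close> holomorphic_derivI unfolding A_def B_def by blast+
  have coords: "complex_coords (q + t *\<^sub>R e) = (z1 + of_real t * u, z2 + of_real t * v)" for t
    using assms(5) z
    by (simp add: linear_add[OF linear_complex_coords] linear_scale[OF linear_complex_coords]
        scaleR_conv_of_real[where 'a = complex])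
  have line: "((\<lambda>s. z2 + s * v) has_field_derivative v) (at (0::complex))"
    by (auto intro!: derivative_eq_intros)
  have da: "((\<lambda>s. a (z2 + s * v)) has_field_derivative A * v) (at 0)"
    and db: "((\<lambda>s. b (z2 + s * v)) has_field_derivative B * v) (at 0)"
    using DERIV_chain2[OF _ line, of a] DERIV_chain2[OF _ line, of b] d by simp_all
  \<comment> \<open>The base point 0 is written \<open>of_real 0\<close> so that the complex
    derivative can be restricted to the real axis in the next step.\<close>
  have "((\<lambda>s. a (z2 + s * v) + b (z2 + s * v) * (z1 + s * u))
          has_field_derivative (v * A + u * b z2) + v * B * z1) (at (of_real 0))"
    by (auto intro!: derivative_eq_intros da db simp: algebra_simps)
  then have "((\<lambda>t. a (z2 + of_real t * v) + b (z2 + of_real t * v) * (z1 + of_real t * u))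
          has_vector_derivative (v * A + u * b z2) + v * B * z1) (at 0)"
    by (rule has_vector_derivative_real_field)
  then show ?thesis
    by (auto dest!: bounded_linear.has_vector_derivative[OF bounded_linear_Re]
        simp: re_affine_def coords z A_def B_def has_real_derivative_iff_has_vector_derivative)
qed

context
  fixes U :: "(real ^ 4) set" and V :: "complex set"
  assumes U: "open U" and V: "open V" and UV: "\<And>q. q \<in> U \<Longrightarrow> snd (complex_coords q) \<in> V"
begin

text \<open>Differentiation is local: \<open>U\<close> is open, so the line through \<open>q\<close>
  stays in \<open>U\<close> for small \<open>t\<close>. Agreement on \<open>U\<close> alone is what
  makes iteration possible, since a partial derivative of \<open>f\<close> is known to have the
  affine form only there.\<close>

lemma has_real_derivative_eq_re_affine:
  assumes "a holomorphic_on V" "b holomorphic_on V" "\<And>q. q \<in> U \<Longrightarrow> f q = re_affine a b q"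
    and "q \<in> U" "complex_coords (axis i 1) = (u, v)"
  shows "((\<lambda>t. f (q + t *\<^sub>R axis i 1)) has_real_derivative
           re_affine (\<lambda>z. v * deriv a z + u * b z) (\<lambda>z. v * deriv b z) q) (at 0)"
proof -
  let ?T = "(\<lambda>t. q + t *\<^sub>R axis i 1) -` U"
  have "open ?T"
    by (rule open_vimage[OF U]) (intro continuous_intros)
  then show ?thesis
    using assms UV
    by (intro has_field_derivative_transform_within_open
        [OF has_real_derivative_re_affine[OF V assms(1,2) UV[OF assms(4)] assms(5)], of ?T]) auto
qed

lemma partial_deriv_eq_re_affine:
  assumes "a holomorphic_on V" "b holomorphic_on V" "\<And>q. q \<in> U \<Longrightarrow> f q = re_affine a b q"
    and "q \<in> U" "complex_coords (axis i 1) = (u, v)"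
  shows "partial_deriv i f q = re_affine (\<lambda>z. v * deriv a z + u * b z) (\<lambda>z. v * deriv b z) q"
  unfolding partial_deriv_def
  by (rule DERIV_imp_deriv[OF has_real_derivative_eq_re_affine[OF assms]])

text \<open>Induction on \<open>k\<close> with \<open>f\<close>, \<open>a\<close> and
  \<open>b\<close> all generalized, because each partial derivative stays in the family but with new
  coefficients. These are again holomorphic on \<open>V\<close>, as \<open>V\<close> is
  open.\<close>

lemma Ck_on_eq_re_affine:
  assumes "a holomorphic_on V" "b holomorphic_on V" "\<And>q. q \<in> U \<Longrightarrow> f q = re_affine a b q"
  shows "Ck_on k f U"
  using assms
proof (induction k arbitrary: f a b)
  have cont: "continuous_on U f" if f: "a holomorphic_on V" "b holomorphic_on V"
    "\<And>q. q \<in> U \<Longrightarrow> f q = re_affine a b q" for f a b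
  proof -
    have comp: "continuous_on U (\<lambda>q. c (snd (complex_coords q)))" if "c holomorphic_on V" for c
      using UV
      by (intro continuous_on_compose2[OF holomorphic_on_imp_continuous_on[OF that]]
          continuous_intros continuous_on_complex_coords) auto
    then have "continuous_on U (re_affine a b)"
      unfolding re_affine_def
      by (intro continuous_intros continuous_on_complex_coords comp f(1,2))
    then show ?thesis
      using f(3) continuous_on_cong by blast
  qed
  case 0
  then show ?case
    using cont by simp
  case (Suc k)
  show ?case
    unfolding Ck_on.simps
  proof (intro conjI allI ballI)
    show "continuous_on U f"
      using cont Suc.prems .
    fix i :: 4
    obtain u v where uv: "complex_coords (axis i 1) = (u, v)"
      by fastforce
    show "(\<lambda>t. f (q + t *\<^sub>R axis i 1)) differentiable at 0" if "q \<in> U" for q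
      using has_real_derivative_eq_re_affine[OF Suc.prems that uv]
      by (meson real_differentiable_def)
    show "Ck_on k (partial_deriv i f) U"
    proof (rule Suc.IH)
      show "(\<lambda>z. v * deriv a z + u * b z) holomorphic_on V" "(\<lambda>z. v * deriv b z) holomorphic_on V"
        by (intro holomorphic_intros Suc.prems V)+
      show "partial_deriv i f q = re_affine (\<lambda>z. v * deriv a z + u * b z) (\<lambda>z. v * deriv b z) q"
        if "q \<in> U" for q
        using partial_deriv_eq_re_affine[OF Suc.prems that uv] .
    qed
  qed
qed

lemma plebanski_II_eq_re_affine:
  assumes ab: "a holomorphic_on V" "b holomorphic_on V"
    and f: "\<And>q. q \<in> U \<Longrightarrow> f q = re_affine a b q"
  shows "regular_plebanski_II_solution f U"
proof -
  note pd = partial_deriv_eq_re_affine[OF ab f]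
  \<comment> \<open>Directions 1 and 2 have \<open>v = 0\<close>, which kills the coefficient of
    \<open>z1\<close>; directions 3 and 4 have \<open>u = 0\<close> and only differentiate the
    coefficients.\<close>
  have first: "partial_deriv 1 f q = re_affine b (\<lambda>z. 0) q"
    "partial_deriv 2 f q = re_affine (\<lambda>z. \<i> * b z) (\<lambda>z. 0) q"
    "partial_deriv 3 f q = re_affine (deriv a) (deriv b) q"
    "partial_deriv 4 f q = re_affine (\<lambda>z. - \<i> * deriv a z) (\<lambda>z. - \<i> * deriv b z) q"
    if "q \<in> U" for q
    using pd[OF _ that complex_coords_axis(1)] pd[OF _ that complex_coords_axis(2)]
      pd[OF _ that complex_coords_axis(3)] pd[OF _ that complex_coords_axis(4)]
    by simp_all
  have hol: "(\<lambda>z. \<i> * b z) holomorphic_on V" "(\<lambda>z. 0) holomorphic_on V"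
    "deriv a holomorphic_on V" "deriv b holomorphic_on V"
    "(\<lambda>z. - \<i> * deriv a z) holomorphic_on V" "(\<lambda>z. - \<i> * deriv b z) holomorphic_on V"
    by (intro holomorphic_intros ab V)+
  \<comment> \<open>The derivative formula is applied again, now to the first derivatives. The two
    mixed terms agree because \<open>\<i> * (- \<i>) = 1\<close>, which is where the sign in
    \<open>z2 = q3 - \<i> * q4\<close> enters.\<close>
  have second: "partial_deriv 1 (partial_deriv 1 f) q = 0"
    "partial_deriv 2 (partial_deriv 2 f) q = 0"
    "partial_deriv 1 (partial_deriv 2 f) q = 0"
    "partial_deriv 2 (partial_deriv 4 f) q = Re (deriv b (snd (complex_coords q)))"
    "partial_deriv 1 (partial_deriv 3 f) q = Re (deriv b (snd (complex_coords q)))"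
    if "q \<in> U" for q
    using partial_deriv_eq_re_affine[OF ab(2) hol(2) first(1) that complex_coords_axis(1)]
      partial_deriv_eq_re_affine[OF hol(1,2) first(2) that complex_coords_axis(2)]
      partial_deriv_eq_re_affine[OF hol(1,2) first(2) that complex_coords_axis(1)]
      partial_deriv_eq_re_affine[OF hol(5,6) first(4) that complex_coords_axis(2)]
      partial_deriv_eq_re_affine[OF hol(3,4) first(3) that complex_coords_axis(1)]
    by (simp_all add: re_affine_def)
  show ?thesis
    unfolding regular_plebanski_II_solution_def smooth_on_def
    using U Ck_on_eq_re_affine[OF ab f] second by simp
qed

end

theorem proposition8:
  fixes \<phi> :: "complex \<times> complex \<Rightarrow> complex"
    and \<Omega> :: "(complex \<times> complex) set"
    and a b :: "complex \<Rightarrow> complex"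
  assumes "open \<Omega>"
    and "holomorphic2_on \<phi> \<Omega>"
    and "a holomorphic_on (snd ` \<Omega>)"
    and "b holomorphic_on (snd ` \<Omega>)"
    and "\<And>z1 z2. (z1, z2) \<in> \<Omega> \<Longrightarrow> \<phi> (z1, z2) = a z2 + b z2 * z1"
  shows "regular_plebanski_II_solution (\<lambda>q. Re (\<phi> (complex_coords q))) (complex_coords -` \<Omega>)"
proof (rule plebanski_II_eq_re_affine)
  show "open (complex_coords -` \<Omega>)"
    using assms(1) continuous_on_complex_coords by (rule open_vimage)
  \<comment> \<open>The projection of \<open>\<Omega>\<close> to the second coordinate serves as
    \<open>V\<close>; it is open because projections are open maps.\<close>
  show "open (snd ` \<Omega>)"
    using assms(1) by (rule open_image_snd)
  show "a holomorphic_on snd ` \<Omega>" "b holomorphic_on snd ` \<Omega>"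
    by fact+
  fix q
  assume q: "q \<in> complex_coords -` \<Omega>"
  then show "snd (complex_coords q) \<in> snd ` \<Omega>"
    by simp
  show "Re (\<phi> (complex_coords q)) = re_affine a b q"
    using q assms(5)[of "fst (complex_coords q)" "snd (complex_coords q)"]
    by (simp add: re_affine_def)
qed

end
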